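(* Let $G=(V,E)$ be a non-oriented, countable, locally finite, connected graph with the following property: there are $x_0\in V$ and $C\ge 0$ such that $\Delta d(\cdot,x_0)\ge -C$ on $V$. Let $T>0$. Then a bounded solution $u$ of the Cauchy problem $$\frac{\partial}{\partial t}u+\Delta u=0\ \text{ on } [0,T)\times V,\qquad u(0,x)=u_0(x)\ \ (x\in V),$$ with initial condition $u_0:V\to\mathbb{R}$ is uniquely determined by $u_0$; that is, any two bounded solutions with the same initial condition $u_0$ coincide on $[0,T)\times V$.
   Context: For $x,y\in V$, $x\sim y$ means that $x$ and $y$ are joined by an edge. The (physical) Laplacian acts on any function $f$ on $V$ by $\Delta f(x)=\sum_{y\sim x}(f(x)-f(y))$, and on functions of $(t,x)$ in the variable $x$. $d:V\times V\to\mathbb{N}$ is the natural graph distance: $d(x,x)=0$, and for $x\ne y$, $d(x,y)$ is the smallest $k$ such that there are vertices $x=x_0\sim x_1\sim\dots\sim x_k=y$. $\Delta d(\cdot,x_0)$ is the Laplacian applied to the function $x\mapsto d(x,x_0)$. A bounded solution is a bounded function $u:[0,T)\times V\to\mathbb{R}$ that is differentiable in $t$ (one-sided at $t=0$) for each $x\in V$ and satisfies the equation and the initial condition. *)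

theory Defs
  imports "HOL-Analysis.Analysis"
begin

text \<open>
  An edge is the unordered set of its end points. Loops (singleton edges) are not excluded;
  they influence neither the Laplacian nor the graph distance.
\<close>

locale undirected_graph =
  fixes V :: "'a set" and E :: "'a set set"
  assumes edge_ends: "\<And>e. e \<in> E \<Longrightarrow> \<exists>x\<in>V. \<exists>y\<in>V. e = {x, y}"

definition adjacent :: "'a set set \<Rightarrow> 'a \<Rightarrow> 'a \<Rightarrow> bool" where
  "adjacent E x y \<longleftrightarrow> {x, y} \<in> E"

definition locally_finite_graph :: "'a set \<Rightarrow> 'a set set \<Rightarrow> bool" where
  "locally_finite_graph V E \<longleftrightarrow> (\<forall>x\<in>V. finite {y. adjacent E x y})"

definition connected_graph :: "'a set \<Rightarrow> 'a set set \<Rightarrow> bool" where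
  "connected_graph V E \<longleftrightarrow> (\<forall>x\<in>V. \<forall>y\<in>V. (adjacent E)\<^sup>*\<^sup>* x y)"

text \<open>
  \<open>(adjacent E ^^ k) x y\<close> holds iff there is a chain of \<open>k\<close> edges from \<open>x\<close> to \<open>y\<close>
  (cf. \<open>relpowp_fun_conv\<close>); for \<open>k = 0\<close> it is equality, so \<open>graph_dist E x x = 0\<close>.
  The value is only meaningful for vertices joined by some chain.
\<close>

definition graph_dist :: "'a set set \<Rightarrow> 'a \<Rightarrow> 'a \<Rightarrow> nat" where
  "graph_dist E x y = (LEAST k. (adjacent E ^^ k) x y)"

text \<open>
  The sum ranges over neighbouring vertices; it is meant for locally finite graphs, where
  this set is finite. Note the sign: this is the nonnegative Laplacian.
\<close>

definition laplacian :: "'a set set \<Rightarrow> ('a \<Rightarrow> real) \<Rightarrow> 'a \<Rightarrow> real" where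
  "laplacian E f x = (\<Sum>y | adjacent E x y. f x - f y)"

text \<open>
  The derivative within \<open>{0..<T}\<close> is the ordinary derivative for \<open>0 < t < T\<close> and the
  right-hand one at \<open>t = 0\<close>. Values of \<open>u\<close> outside \<open>{0..<T} \<times> V\<close> are irrelevant.
\<close>

definition bounded_heat_solution ::
  "'a set \<Rightarrow> 'a set set \<Rightarrow> real \<Rightarrow> ('a \<Rightarrow> real) \<Rightarrow> (real \<Rightarrow> 'a \<Rightarrow> real) \<Rightarrow> bool" where
  "bounded_heat_solution V E T u\<^sub>0 u \<longleftrightarrow>
     bounded ((\<lambda>(t, x). u t x) ` ({0..<T} \<times> V)) \<and>
     (\<forall>t\<in>{0..<T}. \<forall>x\<in>V. \<exists>D. ((\<lambda>s. u s x) has_real_derivative D) (at t within {0..<T})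
        \<and> D + laplacian E (u t) x = 0) \<and>
     (\<forall>x\<in>V. u 0 x = u\<^sub>0 x)"

end

theory Submission
  imports Defs
begin

text \<open>
  The difference \<open>w\<close> of two bounded solutions is a bounded solution that vanishes at time \<open>0\<close>,
  so it suffices to show \<open>w \<le> 0\<close> and to exchange the roles of the two solutions. On a finite
  graph this is the parabolic maximum principle: at a positive space-time maximum the time
  derivative and the Laplacian are both nonnegative. On an infinite graph a maximum need not be
  attained, and the distance \<open>d(\<cdot>, x\<^sub>0)\<close> serves as a barrier that restores compactness. For
  \<open>\<epsilon> > 0\<close> the function \<open>w(t, x) - \<epsilon> (d(x, x\<^sub>0) + (C + 1) t)\<close> is negative far away from \<open>x\<^sub>0\<close>,
  because \<open>w\<close> is bounded, and balls are finite (\<open>finite_ball\<close>) by local finiteness; the bound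
  \<open>\<Delta> d \<ge> -C\<close> makes it a strict subsolution. The maximum principle
  (\<open>strict_subsolution_nonpos\<close>) therefore gives \<open>w(t, x) \<le> \<epsilon> (d(x, x\<^sub>0) + (C + 1) t)\<close>, and
  \<open>\<epsilon> \<rightarrow> 0\<close> finishes the proof. The barrier argument, \<open>bounded_subsolution_nonpos\<close>, allows any
  nonnegative function with finite sublevel sets and Laplacian bounded below in place of the
  distance.
\<close>

lemma (in undirected_graph) adjacent_in_V:
  assumes "adjacent E x y"
  shows "x \<in> V" and "y \<in> V"
  using edge_ends[of "{x, y}"] assms by (auto simp: adjacent_def doubleton_eq_iff)

lemma adjacent_sym: "adjacent E x y \<longleftrightarrow> adjacent E y x"
  by (simp add: adjacent_def insert_commute)

lemma laplacian_linear_combination: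
  "laplacian E (\<lambda>y. a * f y + b * g y + c) x = a * laplacian E f x + b * laplacian E g x"
  by (simp add: laplacian_def sum_distrib_left flip: sum.distrib)
    (simp add: algebra_simps)

lemma (in undirected_graph) finite_chains_to:
  assumes lf: "locally_finite_graph V E" and "x\<^sub>0 \<in> V"
  shows "finite {x. (adjacent E ^^ k) x x\<^sub>0} \<and> {x. (adjacent E ^^ k) x x\<^sub>0} \<subseteq> V"
proof (induction k)
  case 0
  then show ?case using \<open>x\<^sub>0 \<in> V\<close> by auto
next
  case (Suc k)
  have eq: "{x. (adjacent E ^^ Suc k) x x\<^sub>0}
      = (\<Union>y\<in>{y. (adjacent E ^^ k) y x\<^sub>0}. {x. adjacent E y x})"
    unfolding relpowp_Suc_left using adjacent_sym[of E] by auto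
  show ?case
    unfolding eq using Suc.IH lf adjacent_in_V by (auto simp: locally_finite_graph_def)
qed

lemma (in undirected_graph) finite_ball:
  assumes lf: "locally_finite_graph V E" and conn: "connected_graph V E" and x0: "x\<^sub>0 \<in> V"
  shows "finite {x \<in> V. real (graph_dist E x x\<^sub>0) \<le> r}"
proof (rule finite_subset)
  show "{x \<in> V. real (graph_dist E x x\<^sub>0) \<le> r}
      \<subseteq> (\<Union>k\<in>{..nat \<lfloor>r\<rfloor>}. {x. (adjacent E ^^ k) x x\<^sub>0})"
  proof
    fix x assume x: "x \<in> {x \<in> V. real (graph_dist E x x\<^sub>0) \<le> r}"
    then have "(adjacent E)\<^sup>*\<^sup>* x x\<^sub>0"
      using conn x0 by (auto simp: connected_graph_def)
    then obtain k where "(adjacent E ^^ k) x x\<^sub>0"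
      by (auto simp: rtranclp_power)
    then have "(adjacent E ^^ graph_dist E x x\<^sub>0) x x\<^sub>0"
      unfolding graph_dist_def by (rule LeastI)
    moreover have "graph_dist E x x\<^sub>0 \<le> nat \<lfloor>r\<rfloor>"
      using x by (auto simp: le_nat_floor)
    ultimately show "x \<in> (\<Union>k\<in>{..nat \<lfloor>r\<rfloor>}. {x. (adjacent E ^^ k) x x\<^sub>0})"
      by auto
  qed
  show "finite (\<Union>k\<in>{..nat \<lfloor>r\<rfloor>}. {x. (adjacent E ^^ k) x x\<^sub>0})"
    using finite_chains_to[OF lf x0] by auto
qed

text \<open>
  The parabolic maximum principle. A positive value would make \<open>z\<close> attain a positive maximum
  over \<open>{0..s} \<times> V\<close>, since only the finite set \<open>K\<close> of vertices can carry positive values. There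
  the (left) time derivative and the Laplacian are both nonnegative, against strictness.
\<close>

lemma (in undirected_graph) strict_subsolution_nonpos:
  fixes z D :: "real \<Rightarrow> 'a \<Rightarrow> real"
  assumes "finite K" "K \<subseteq> V"
    and outside: "\<And>t x. t \<in> {0..s} \<Longrightarrow> x \<in> V - K \<Longrightarrow> z t x \<le> 0"
    and initial: "\<And>x. x \<in> V \<Longrightarrow> z 0 x \<le> 0"
    and deriv: "\<And>t x. t \<in> {0..s} \<Longrightarrow> x \<in> V \<Longrightarrow>
      ((\<lambda>t. z t x) has_real_derivative D t x) (at t within {0..s})"
    and strict: "\<And>t x. t \<in> {0..s} \<Longrightarrow> x \<in> V \<Longrightarrow> D t x + laplacian E (z t) x < 0"
    and t: "t \<in> {0..s}" and x: "x \<in> V"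
  shows "z t x \<le> 0"
proof (rule ccontr)
  assume "\<not> z t x \<le> 0"
  then have pos: "z t x > 0" by simp
  have "x \<in> K" using outside[OF t] pos x by force
  have "\<exists>m\<in>{0..s}. \<forall>r\<in>{0..s}. z r y \<le> z m y" if "y \<in> V" for y
  proof (rule continuous_attains_sup)
    show "continuous_on {0..s} (\<lambda>r. z r y)"
      by (rule DERIV_continuous_on[OF deriv[OF _ that]])
  qed (use t in auto)
  then obtain m where m: "\<And>y. y \<in> V \<Longrightarrow> m y \<in> {0..s}"
      and m_max: "\<And>y r. y \<in> V \<Longrightarrow> r \<in> {0..s} \<Longrightarrow> z r y \<le> z (m y) y"
    by metis
  define M where "M = Max ((\<lambda>y. z (m y) y) ` K)"
  have "M \<in> (\<lambda>y. z (m y) y) ` K"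
    unfolding M_def using \<open>finite K\<close> \<open>x \<in> K\<close> by (intro Max_in) auto
  then obtain p where p: "p \<in> K" and Mp: "M = z (m p) p" by auto
  have pV: "p \<in> V" using p \<open>K \<subseteq> V\<close> by auto
  have K_max: "z r y \<le> z (m p) p" if "r \<in> {0..s}" "y \<in> K" for r y
  proof -
    have "z r y \<le> z (m y) y" using m_max that \<open>K \<subseteq> V\<close> by auto
    also have "\<dots> \<le> M" unfolding M_def using \<open>finite K\<close> that by simp
    finally show ?thesis using Mp by simp
  qed
  have max_pos: "z (m p) p > 0"
    using K_max[OF t \<open>x \<in> K\<close>] pos by linarith
  have V_max: "z r y \<le> z (m p) p" if "r \<in> {0..s}" "y \<in> V" for r y
    using K_max[of r y] outside[of r y] max_pos that by (cases "y \<in> K") auto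
  have mp: "m p \<in> {0..s}" "m p > 0"
    using m[OF pV] max_pos initial[OF pV] by (auto simp: less_le)
  have "0 \<le> laplacian E (z (m p)) p"
    unfolding laplacian_def using V_max[OF mp(1)] adjacent_in_V
    by (intro sum_nonneg) auto
  \<comment> \<open>The maximum may sit at the end point \<open>s\<close>, but not at \<open>0\<close>, so it is compared with
    earlier times.\<close>
  moreover have "0 \<le> D (m p) p"
  proof (rule ccontr)
    assume "\<not> 0 \<le> D (m p) p"
    then obtain d where "d > 0"
        and d: "\<And>h. 0 < h \<Longrightarrow> m p - h \<in> {0..s} \<Longrightarrow> h < d \<Longrightarrow> z (m p) p < z (m p - h) p"
      using has_real_derivative_neg_dec_left[OF deriv[OF mp(1) pV]] by auto
    define h where "h = min (d / 2) (m p)"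
    have h: "0 < h" "m p - h \<in> {0..s}" "h < d"
      using \<open>d > 0\<close> mp by (auto simp: h_def)
    show False using d[OF h] V_max[OF h(2) pV] by simp
  qed
  ultimately show False using strict[OF mp(1) pV] by linarith
qed

text \<open>
  The barrier argument. The penalty \<open>\<epsilon> (h + (C + 1) t)\<close> grows in time at a rate exceeding the
  bound \<open>C\<close> on \<open>-\<Delta> h\<close>, which makes the subsolution strict; and it exceeds the bound
  \<open>B\<close> of \<open>w\<close> off the finite set \<open>h \<le> B / \<epsilon>\<close>.
\<close>

lemma (in undirected_graph) bounded_subsolution_nonpos:
  fixes w D :: "real \<Rightarrow> 'a \<Rightarrow> real" and h :: "'a \<Rightarrow> real"
  assumes "C \<ge> 0"
    and h_nonneg: "\<And>x. x \<in> V \<Longrightarrow> h x \<ge> 0"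
    and sublevel: "\<And>r. finite {x \<in> V. h x \<le> r}"
    and lap_h: "\<And>x. x \<in> V \<Longrightarrow> laplacian E h x \<ge> - C"
    and bound: "\<And>t x. t \<in> {0..s} \<Longrightarrow> x \<in> V \<Longrightarrow> w t x \<le> B"
    and initial: "\<And>x. x \<in> V \<Longrightarrow> w 0 x \<le> 0"
    and deriv: "\<And>t x. t \<in> {0..s} \<Longrightarrow> x \<in> V \<Longrightarrow>
      ((\<lambda>t. w t x) has_real_derivative D t x) (at t within {0..s})"
    and sub: "\<And>t x. t \<in> {0..s} \<Longrightarrow> x \<in> V \<Longrightarrow> D t x + laplacian E (w t) x \<le> 0"
    and t: "t \<in> {0..s}" and x: "x \<in> V"
  shows "w t x \<le> 0"
proof -
  define A where "A = h x + (C + 1) * t"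
  have "A \<ge> 0" using h_nonneg[OF x] \<open>C \<ge> 0\<close> t by (simp add: A_def)
  have barrier: "w t x \<le> \<epsilon> * A" if "\<epsilon> > 0" for \<epsilon>
  proof -
    define z where "z r y = 1 * w r y + (- \<epsilon>) * h y + (- \<epsilon> * (C + 1) * r)" for r y
    have "z t x \<le> 0"
    proof (rule strict_subsolution_nonpos[where z = z and K = "{x \<in> V. h x \<le> B / \<epsilon>}"
          and D = "\<lambda>r y. D r y - \<epsilon> * (C + 1)"])
      fix r y assume r: "r \<in> {0..s}" and y: "y \<in> V - {x \<in> V. h x \<le> B / \<epsilon>}"
      have "B < \<epsilon> * h y" using y that by (auto simp: field_simps not_le)
      moreover have "0 \<le> \<epsilon> * (C + 1) * r" using that \<open>C \<ge> 0\<close> r by simp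
      ultimately show "z r y \<le> 0" using bound[OF r, of y] y by (auto simp: z_def)
    next
      fix y assume y: "y \<in> V"
      have "0 \<le> \<epsilon> * h y" using that h_nonneg[OF y] by simp
      then show "z 0 y \<le> 0" using initial[OF y] by (simp add: z_def)
    next
      fix r y assume r: "r \<in> {0..s}" and y: "y \<in> V"
      show "((\<lambda>r. z r y) has_real_derivative D r y - \<epsilon> * (C + 1)) (at r within {0..s})"
        unfolding z_def by (auto intro!: derivative_eq_intros deriv r y)
      have "laplacian E (z r) y = laplacian E (w r) y - \<epsilon> * laplacian E h y"
        unfolding z_def laplacian_linear_combination by simp
      moreover have "- (\<epsilon> * laplacian E h y) \<le> \<epsilon> * C"
        using mult_left_mono[OF lap_h[OF y], of \<epsilon>] that by simp
      ultimately show "D r y - \<epsilon> * (C + 1) + laplacian E (z r) y < 0"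
        using sub[OF r y] that by (simp add: algebra_simps)
    qed (use sublevel t x in auto)
    then show ?thesis by (simp add: z_def A_def algebra_simps)
  qed
  show ?thesis
  proof (rule field_le_epsilon)
    fix e :: real assume "e > 0"
    \<comment> \<open>The \<open>1\<close> in the denominator covers the case \<open>A = 0\<close>.\<close>
    have "w t x \<le> e / (A + 1) * A"
      using barrier[of "e / (A + 1)"] \<open>e > 0\<close> \<open>A \<ge> 0\<close> by simp
    also have "\<dots> \<le> e" using \<open>e > 0\<close> \<open>A \<ge> 0\<close> by (simp add: field_simps)
    finally show "w t x \<le> 0 + e" by simp
  qed
qed

lemma (in undirected_graph) bounded_heat_solution_le:
  fixes h :: "'a \<Rightarrow> real"
  assumes "C \<ge> 0"
    and "\<And>x. x \<in> V \<Longrightarrow> h x \<ge> 0"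
    and "\<And>r. finite {x \<in> V. h x \<le> r}"
    and "\<And>x. x \<in> V \<Longrightarrow> laplacian E h x \<ge> - C"
    and u: "bounded_heat_solution V E T u\<^sub>0 u" and v: "bounded_heat_solution V E T u\<^sub>0 v"
    and t: "t \<in> {0..<T}" and x: "x \<in> V"
  shows "u t x \<le> v t x"
proof -
  obtain Bu where Bu: "\<And>r y. r \<in> {0..<T} \<Longrightarrow> y \<in> V \<Longrightarrow> \<bar>u r y\<bar> \<le> Bu"
    using u unfolding bounded_heat_solution_def bounded_iff by fastforce
  obtain Bv where Bv: "\<And>r y. r \<in> {0..<T} \<Longrightarrow> y \<in> V \<Longrightarrow> \<bar>v r y\<bar> \<le> Bv"
    using v unfolding bounded_heat_solution_def bounded_iff by fastforce
  have sol: "((\<lambda>s. f s y) has_real_derivative - laplacian E (f r) y) (at r within {0..<T})"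
    if f: "bounded_heat_solution V E T u\<^sub>0 f" "r \<in> {0..<T}" "y \<in> V" for f r y
  proof -
    obtain D where "((\<lambda>s. f s y) has_real_derivative D) (at r within {0..<T})"
        and "D + laplacian E (f r) y = 0"
      using f unfolding bounded_heat_solution_def by blast
    moreover from this have "D = - laplacian E (f r) y" by linarith
    ultimately show ?thesis by simp
  qed
  \<comment> \<open>The maximum principle needs a compact time interval; \<open>{0..t}\<close> suffices.\<close>
  have sub: "{0..t} \<subseteq> {0..<T}" using t by auto
  have "u t x - v t x \<le> 0"
  proof (rule bounded_subsolution_nonpos[where s = t and B = "Bu + Bv" and h = h and C = C
        and w = "\<lambda>r y. u r y - v r y"
        and D = "\<lambda>r y. - laplacian E (u r) y + laplacian E (v r) y"])
    fix r y assume r: "r \<in> {0..t}" and y: "y \<in> V"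
    then have r': "r \<in> {0..<T}" using sub by auto
    show "u r y - v r y \<le> Bu + Bv" using Bu[OF r' y] Bv[OF r' y] by linarith
    have "((\<lambda>r. u r y - v r y) has_real_derivative
        - laplacian E (u r) y - - laplacian E (v r) y) (at r within {0..<T})"
      by (intro DERIV_diff sol u v r' y)
    then show "((\<lambda>r. u r y - v r y) has_real_derivative
        - laplacian E (u r) y + laplacian E (v r) y) (at r within {0..t})"
      using DERIV_subset[OF _ sub] by simp
    show "- laplacian E (u r) y + laplacian E (v r) y + laplacian E (\<lambda>y. u r y - v r y) y \<le> 0"
      using laplacian_linear_combination[of E 1 "u r" "- 1" "v r" 0 y] by simp
  next
    fix y assume "y \<in> V"
    then show "u 0 y - v 0 y \<le> 0" using u v by (simp add: bounded_heat_solution_def)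
  qed (use assms in auto)
  then show ?thesis by simp
qed

theorem theorem4p15:
  fixes V :: "'a set" and E :: "'a set set"
    and x\<^sub>0 :: 'a and C T :: real
    and u\<^sub>0 :: "'a \<Rightarrow> real" and u v :: "real \<Rightarrow> 'a \<Rightarrow> real"
  assumes "undirected_graph V E"
    and "countable V"
    and "locally_finite_graph V E"
    and "connected_graph V E"
    and "x\<^sub>0 \<in> V" and "C \<ge> 0"
    and "\<forall>x\<in>V. laplacian E (\<lambda>z. real (graph_dist E z x\<^sub>0)) x \<ge> - C"
    and "T > 0"
    and "bounded_heat_solution V E T u\<^sub>0 u"
    and "bounded_heat_solution V E T u\<^sub>0 v"
  shows "\<forall>t\<in>{0..<T}. \<forall>x\<in>V. u t x = v t x"
proof (intro ballI)
  interpret undirected_graph V E by fact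
  fix t x assume t: "t \<in> {0..<T}" and x: "x \<in> V"
  note le = bounded_heat_solution_le[where h = "\<lambda>z. real (graph_dist E z x\<^sub>0)", OF \<open>C \<ge> 0\<close>
      _ finite_ball[OF \<open>locally_finite_graph V E\<close> \<open>connected_graph V E\<close> \<open>x\<^sub>0 \<in> V\<close>] _ _ _ t x]
  show "u t x = v t x"
  proof (rule antisym)
    show "u t x \<le> v t x" by (rule le) (use assms in auto)
    show "v t x \<le> u t x" by (rule le) (use assms in auto)
  qed
qed

end
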